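(* Let $E(x)=\sum_{n>0} e(n)\frac{x^n}{n!}$ be an exponential generating function, where $(e(n))_{n\ge 1}$ is a sequence of integers, and let $E^{\Delta}(n,k)$ be the composita of $E(x)$. Then for all positive integers $k\leq n$ the number $$\frac{n!}{k!}\,E^{\Delta}(n,k)$$ is an integer.
   Context: An exponential generating function (with zero constant term) is a formal power series $\sum_{n\ge 1} \frac{e(n)}{n!}x^n$, where $e(n)$ is a sequence of integers. For a formal power series $F(x)=\sum_{n>0} f(n)x^n$ with zero constant term, the composita $F^{\Delta}(n,k)$ (for positive integers $n,k$) is the coefficient of $x^n$ in $[F(x)]^k$, i.e. $[F(x)]^k=\sum_{n>0}F^{\Delta}(n,k)x^n$. Equivalently, $$F^{\Delta}(n,k)=\sum_{\lambda_1+\cdots+\lambda_k=n,\ \lambda_i\ge 1} f(\lambda_1)f(\lambda_2)\cdots f(\lambda_k),$$ the sum being over all compositions (ordered tuples of positive integers) of $n$ into exactly $k$ parts. For the series $E(x)$ the ordinary coefficients are $f(n)=e(n)/n!$. *)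

theory Defs
  imports "HOL-Computational_Algebra.Formal_Power_Series"
begin

text \<open>
  The value \<open>e 0\<close> is ignored: the sequence is indexed by the positive integers and the series has
  zero constant term.
\<close>
definition egf :: "(nat \<Rightarrow> int) \<Rightarrow> rat fps" where
  "egf e = Abs_fps (\<lambda>n. if n = 0 then 0 else of_int (e n) / fact n)"

text \<open>
  Intended for \<open>fps_nth F 0 = 0\<close> and positive \<open>n\<close>, \<open>k\<close>.
\<close>
definition composita :: "'a::comm_ring_1 fps \<Rightarrow> nat \<Rightarrow> nat \<Rightarrow> 'a" where
  "composita F n k = fps_nth (F ^ k) n"

lemma composita_eq_sum_compositions:
  fixes F :: "'a::comm_ring_1 fps"
  assumes "fps_nth F 0 = 0"
  shows "composita F n k =
    (\<Sum>l | length l = k \<and> sum_list l = n \<and> (\<forall>i\<in>set l. i \<ge> 1). prod_list (map (fps_nth F) l))"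
proof -
  have "composita F n k = (\<Sum>l\<in>natpermute n k. prod_list (map (fps_nth F) l))"
  proof (cases k)
    case 0
    have "natpermute n 0 = (if n = 0 then {[]} else {})"
      by (auto simp: natpermute_def)
    then show ?thesis using 0 by (simp add: composita_def)
  next
    case (Suc m)
    have "(\<Prod>j=0..m. fps_nth F (l ! j)) = prod_list (map (fps_nth F) l)"
      if "l \<in> natpermute n (Suc m)" for l
      using that
      by (simp add: natpermute_def prod.list_conv_set_nth atLeast0LessThan lessThan_Suc_atMost atLeast0AtMost)
    then show ?thesis
      unfolding composita_def Suc fps_power_nth_Suc by (intro sum.cong) auto
  qed
  also have "\<dots> = (\<Sum>l | length l = k \<and> sum_list l = n \<and> (\<forall>i\<in>set l. i \<ge> 1).
      prod_list (map (fps_nth F) l))"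
  proof (rule sum.mono_neutral_right)
    show "finite (natpermute n k)" by (rule natpermute_finite)
    show "{l. length l = k \<and> sum_list l = n \<and> (\<forall>i\<in>set l. i \<ge> 1)} \<subseteq> natpermute n k"
      by (auto simp: natpermute_def)
    show "\<forall>l \<in> natpermute n k - {l. length l = k \<and> sum_list l = n \<and> (\<forall>i\<in>set l. i \<ge> 1)}.
        prod_list (map (fps_nth F) l) = 0"
    proof
      fix l assume "l \<in> natpermute n k - {l. length l = k \<and> sum_list l = n \<and> (\<forall>i\<in>set l. i \<ge> 1)}"
      then have "0 \<in> set l"
        by (auto simp: natpermute_def not_le)
      then obtain xs ys where "l = xs @ 0 # ys" by (auto dest: split_list)
      then show "prod_list (map (fps_nth F) l) = 0" using assms by simp
    qed
  qed
  finally show ?thesis .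
qed

end

theory Submission
  imports Defs
begin

text \<open>
  Call a series a Hurwitz series if multiplying its \<open>n\<close>-th coefficient by \<open>n!\<close> always gives an
  integer. The claim is that the divided power \<open>F\<^sup>k / k!\<close> of a Hurwitz series \<open>F\<close> with zero constant
  term is again Hurwitz. Dividing by \<open>k!\<close> is harmless because of the identity
  \<open>(F\<^sup>k / k!)' = F\<^sup>k\<^sup>-\<^sup>1 / (k-1)! \<cdot> F'\<close>: the factor \<open>k\<close> that the power rule
  produces cancels against the factorial. Differentiation merely shifts the sequence
  \<open>n! [x\<^sup>n] F\<close>, so a series is Hurwitz as soon as its derivative is Hurwitz and its constant term is
  an integer (\<open>hurwitz_if_deriv\<close>), and Hurwitz series are closed under products because binomial
  coefficients are integers (\<open>hurwitz_mult\<close>). Induction on \<open>k\<close> then gives \<open>hurwitz_divided_power\<close>.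
\<close>

definition hurwitz :: "'a::field_char_0 fps \<Rightarrow> bool" where
  "hurwitz F \<longleftrightarrow> (\<forall>n. fact n * fps_nth F n \<in> \<int>)"

text \<open>
  The sequence \<open>n! [x\<^sup>n] (F * G)\<close> is the binomial convolution of the sequences belonging to the
  factors.
\<close>
lemma hurwitz_mult:
  assumes "hurwitz F" and "hurwitz G"
  shows "hurwitz (F * G)"
  unfolding hurwitz_def
proof
  fix n
  have "fact n * fps_nth (F * G) n =
      (\<Sum>i=0..n. of_nat (n choose i) * (fact i * fps_nth F i) * (fact (n - i) * fps_nth G (n - i)))"
    by (auto simp: fps_mult_nth sum_distrib_left binomial_fact intro!: sum.cong)
  also have "\<dots> \<in> \<int>"
    using assms unfolding hurwitz_def by (blast intro: Ints_sum Ints_mult[OF Ints_mult] Ints_of_nat)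
  finally show "fact n * fps_nth (F * G) n \<in> \<int>" .
qed

lemma fact_mult_nth_fps_deriv:
  "fact n * fps_nth (fps_deriv F) n = fact (Suc n) * fps_nth F (Suc n)"
  for F :: "'a::field_char_0 fps"
  by (simp add: algebra_simps)

lemma hurwitz_deriv:
  assumes "hurwitz F"
  shows "hurwitz (fps_deriv F)"
  using assms unfolding hurwitz_def fact_mult_nth_fps_deriv by blast

lemma hurwitz_if_deriv:
  assumes "fps_nth F 0 \<in> \<int>" and "hurwitz (fps_deriv F)"
  shows "hurwitz F"
  unfolding hurwitz_def
proof
  fix n
  show "fact n * fps_nth F n \<in> \<int>"
  proof (cases n)
    case 0
    then show ?thesis using assms(1) by simp
  next
    case (Suc m)
    then show ?thesis
      using assms(2) unfolding hurwitz_def fact_mult_nth_fps_deriv by blast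
  qed
qed

lemma fps_deriv_divided_power:
  fixes F :: "'a::field_char_0 fps"
  shows "fps_deriv (fps_const (1 / fact (Suc k)) * F ^ Suc k) =
    fps_const (1 / fact k) * F ^ k * fps_deriv F"
proof -
  have "fps_const (1 / fact (Suc k)) * fps_const (of_nat (Suc k)) = fps_const (1 / fact k :: 'a)"
    by (simp add: field_simps del: of_nat_Suc)
  moreover have "fps_deriv (fps_const (1 / fact (Suc k)) * F ^ Suc k) =
      fps_const (1 / fact (Suc k)) * fps_const (of_nat (Suc k)) * (F ^ k * fps_deriv F)"
    by (simp add: fps_deriv_power' fps_of_nat mult_ac del: fact_Suc of_nat_Suc power_Suc)
  ultimately show ?thesis by (simp add: mult_ac)
qed

text \<open>
  The zero constant term makes the constant term of \<open>F\<^sup>k / k!\<close> an integer; without it the claim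
  fails, for instance for \<open>F = 1\<close> and \<open>k = 2\<close>.
\<close>
lemma hurwitz_divided_power:
  assumes "hurwitz F" and "fps_nth F 0 = 0"
  shows "hurwitz (fps_const (1 / fact k) * F ^ k)"
proof (induction k)
  case 0
  show ?case by (auto simp: hurwitz_def)
next
  case (Suc k)
  show ?case
  proof (rule hurwitz_if_deriv)
    show "fps_nth (fps_const (1 / fact (Suc k)) * F ^ Suc k) 0 \<in> \<int>"
      using assms(2) by simp
    show "hurwitz (fps_deriv (fps_const (1 / fact (Suc k)) * F ^ Suc k))"
      unfolding fps_deriv_divided_power by (intro hurwitz_mult Suc.IH hurwitz_deriv assms(1))
  qed
qed

lemma hurwitz_egf: "hurwitz (egf e)"
  by (simp add: hurwitz_def egf_def)

theorem theorem3:
  fixes e :: "nat \<Rightarrow> int" and n k :: nat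
  assumes "1 \<le> k" and "k \<le> n"
  shows "fact n / fact k * composita (egf e) n k \<in> \<int>"
proof -
  have "hurwitz (fps_const (1 / fact k) * egf e ^ k)"
    by (intro hurwitz_divided_power hurwitz_egf) (simp add: egf_def)
  then have "fact n * fps_nth (fps_const (1 / fact k) * egf e ^ k) n \<in> \<int>"
    unfolding hurwitz_def by blast
  then show ?thesis by (simp add: composita_def)
qed

end
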